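(* Let $(S,N)$ be a quadratic normalisation of class $(4,3)$. Then for every $p\ge1$ and every word $w$ over $S$ of length $p$, one has $N(w)=\overline{N}_{\delta_p}(w)$, where the finite sequences of positive integers $\delta_p$ are defined by $\delta_1=\varepsilon$ (the empty sequence) and $\delta_p=\mathrm{sh}(\delta_{p-1})\,|\,1\,|\,2\,|\cdots|\,p-1$ for $p\ge2$, with $\mathrm{sh}$ the map increasing every entry of a sequence by $1$.
   Context: For a set $S$, $S^*$ is the free monoid of words over $S$, $\|w\|$ is word length, $u|v$ is concatenation (of words or of sequences), $S^{[p]}$ is the set of words of length $p$. A normalisation is a pair $(S,N)$ with $N:S^*\to S^*$ such that for all words $u,v,w$: $\|N(w)\|=\|w\|$; $\|w\|=1$ implies $N(w)=w$; $N(u|N(w)|v)=N(u|w|v)$. A word is $N$-normal if $N(w)=w$. $\overline{N}$ is the restriction of $N$ to $S^{[2]}$; $\overline{N}_i$ applies $\overline{N}$ to the entries in positions $i,i+1$; for a sequence of positions $u=i_1|\cdots|i_n$, $\overline{N}_u=\overline{N}_{i_n}\circ\cdots\circ\overline{N}_{i_1}$ ($\overline{N}_{i_1}$ applied first; identity for the empty sequence). $(S,N)$ is quadratic if (a) a word is $N$-normal iff each of its length-two factors is, and (b) for every word $w$ there is a finite sequence $u$ of positions with $N(w)=\overline{N}_u(w)$. It is of class $(4,3)$ if $N(w)=\overline{N}_{1212}(w)=\overline{N}_{212}(w)$ for all $w\in S^{[3]}$. Examples: $\delta_2=1$, $\delta_3=212$, $\delta_4=323123$. *)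

theory Defs
  imports Main "HOL-Library.Sublist"
begin

text \<open>Words over \<open>S\<close> are the elements of \<open>lists S\<close>; the values of \<open>N\<close> on other lists are irrelevant.\<close>

definition normalisation :: "'a set \<Rightarrow> ('a list \<Rightarrow> 'a list) \<Rightarrow> bool" where
  "normalisation S N \<longleftrightarrow>
     (\<forall>w\<in>lists S. N w \<in> lists S) \<and>
     (\<forall>w\<in>lists S. length (N w) = length w) \<and>
     (\<forall>w\<in>lists S. length w = 1 \<longrightarrow> N w = w) \<and>
     (\<forall>u\<in>lists S. \<forall>v\<in>lists S. \<forall>w\<in>lists S. N (u @ N w @ v) = N (u @ w @ v))"

definition normal :: "('a list \<Rightarrow> 'a list) \<Rightarrow> 'a list \<Rightarrow> bool" where
  "normal N w \<longleftrightarrow> N w = w"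

text \<open>Positions are counted from 1, whereas list indices start at 0. The map at position \<open>i\<close> only
  makes sense on words of length at least \<open>i + 1\<close> (and for \<open>i \<ge> 1\<close>); outside this range it is
  set to be the identity.\<close>

definition Nbar :: "('a list \<Rightarrow> 'a list) \<Rightarrow> nat \<Rightarrow> 'a list \<Rightarrow> 'a list" where
  "Nbar N i w =
     (if 1 \<le> i \<and> i + 1 \<le> length w
      then take (i - 1) w @ N [w ! (i - 1), w ! i] @ drop (i + 1) w
      else w)"

text \<open>The first entry of the sequence of positions is applied first.\<close>

definition Nbar_seq :: "('a list \<Rightarrow> 'a list) \<Rightarrow> nat list \<Rightarrow> 'a list \<Rightarrow> 'a list" where
  "Nbar_seq N u w = fold (Nbar N) u w"

definition quadratic :: "'a set \<Rightarrow> ('a list \<Rightarrow> 'a list) \<Rightarrow> bool" where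
  "quadratic S N \<longleftrightarrow>
     (\<forall>w\<in>lists S. normal N w \<longleftrightarrow> (\<forall>v. sublist v w \<and> length v = 2 \<longrightarrow> normal N v)) \<and>
     (\<forall>w\<in>lists S. \<exists>u. set u \<subseteq> {1..<length w} \<and> N w = Nbar_seq N u w)"

definition class_4_3 :: "'a set \<Rightarrow> ('a list \<Rightarrow> 'a list) \<Rightarrow> bool" where
  "class_4_3 S N \<longleftrightarrow>
     (\<forall>w\<in>lists S. length w = 3 \<longrightarrow>
        N w = Nbar_seq N [1, 2, 1, 2] w \<and> N w = Nbar_seq N [2, 1, 2] w)"

text \<open>The value at 0 is a dummy; the recursion step \<open>Suc (Suc n)\<close> is the case \<open>p = n + 2\<close>,
  where \<open>[1..<p]\<close> lists \<open>1, \<dots>, p - 1\<close>.\<close>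

fun delta :: "nat \<Rightarrow> nat list" where
  "delta 0 = []"
| "delta (Suc 0) = []"
| "delta (Suc (Suc n)) = map Suc (delta (Suc n)) @ [1..<Suc (Suc n)]"

lemma delta_examples: "delta 2 = [1]" "delta 3 = [2, 1, 2]" "delta 4 = [3, 2, 3, 1, 2, 3]"
  by (simp_all add: numeral_eq_Suc)

text \<open>On words of length \<open>p\<close>, the sequence \<open>delta p\<close> never uses the identity convention in
  the definition of \<open>Nbar\<close>.\<close>

lemma set_delta: "set (delta p) \<subseteq> {1..<p}"
  by (induction p rule: delta.induct) auto

end

theory Submission
  imports Defs
begin

text \<open>Because \<open>N (s # w) = N (s # N w)\<close>, it suffices to see that one sweep \<open>1, 2, \<dots>, n\<close> turns
  \<open>s # w\<close> into a normal word whenever \<open>w = t\<^sub>1 \<dots> t\<^sub>n\<close> is normal. The sweep rewrites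
  \<open>s\<^sub>i\<^sub>-\<^sub>1 t\<^sub>i\<close> into \<open>t'\<^sub>i s\<^sub>i\<close>, starting with \<open>s\<^sub>0 = s\<close>. Since position 2 does nothing on
  \<open>s\<^sub>i\<^sub>-\<^sub>1 t\<^sub>i t\<^sub>i\<^sub>+\<^sub>1\<close>, the identity \<open>N = Nbar_seq N [2, 1, 2]\<close> shows that \<open>t'\<^sub>i t'\<^sub>i\<^sub>+\<^sub>1 s\<^sub>i\<^sub>+\<^sub>1\<close> is normal,
  and hence so is \<open>t'\<^sub>i t'\<^sub>i\<^sub>+\<^sub>1\<close>. The last factor \<open>t'\<^sub>n s\<^sub>n\<close> is a value of \<open>N\<close>.\<close>

text \<open>A factor of length two is either the initial pair or a factor of the tail. This gives
  the first condition of \<open>quadratic\<close> a form suited to list induction.\<close>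

lemma all_sublist_length2_iff_successively:
  "(\<forall>v. sublist v w \<and> length v = 2 \<longrightarrow> P v) \<longleftrightarrow> successively (\<lambda>x y. P [x, y]) w"
proof (induction w rule: induct_list012)
  case (3 x y zs)
  have "sublist v (x # y # zs) \<and> length v = 2 \<longleftrightarrow>
      v = [x, y] \<or> sublist v (y # zs) \<and> length v = 2" for v
    by (auto simp: sublist_Cons_right prefix_Cons length_Suc_conv numeral_2_eq_2)
  then show ?case
    using 3(2) by auto
qed (auto dest: sublist_length_le)

lemma normal_iff_successively:
  assumes "quadratic S N" "w \<in> lists S"
  shows "normal N w \<longleftrightarrow> successively (\<lambda>x y. normal N [x, y]) w"
  using assms all_sublist_length2_iff_successively[of w "normal N"]
  unfolding quadratic_def by blast

lemma normal_N:
  assumes "normalisation S N" "w \<in> lists S"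
  shows "normal N (N w)"
  using assms unfolding normalisation_def normal_def
  by (metis append_Nil append_Nil2 lists.Nil)

lemma N_pairE:
  assumes "normalisation S N" "x \<in> S" "y \<in> S"
  obtains a b where "N [x, y] = [a, b]" "a \<in> S" "b \<in> S"
proof -
  have "length (N [x, y]) = 2" "N [x, y] \<in> lists S"
    using assms by (auto simp: normalisation_def)
  then show thesis
    using that by (auto simp: length_Suc_conv numeral_2_eq_2)
qed

text \<open>In range, \<open>Nbar\<close> replaces a factor by its image under \<open>N\<close>,
  which the last condition of \<open>normalisation\<close> makes invisible to
  \<open>N\<close>.\<close>

lemma
  assumes "normalisation S N" "w \<in> lists S"
  shows Nbar_in_lists: "Nbar N i w \<in> lists S"
    and N_Nbar: "N (Nbar N i w) = N w"
proof -
  have "Nbar N i w \<in> lists S \<and> N (Nbar N i w) = N w"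
  proof (cases "1 \<le> i \<and> i + 1 \<le> length w")
    case True
    then have len: "i - 1 < length w" "i < length w"
      by auto
    define u v where "u = take (i - 1) w" and "v = drop (i + 1) w"
    have w: "w = u @ [w ! (i - 1), w ! i] @ v"
      using True len id_take_nth_drop[of "i - 1" w] Cons_nth_drop_Suc[of i w]
      by (simp add: u_def v_def)
    have uv: "u \<in> lists S" "v \<in> lists S" "[w ! (i - 1), w ! i] \<in> lists S"
      using w assms(2) by (metis append_in_lists_conv)+
    have "Nbar N i w = u @ N [w ! (i - 1), w ! i] @ v"
      using True by (simp add: Nbar_def u_def v_def)
    then show ?thesis
      using assms(1) uv w unfolding normalisation_def by (metis append_in_lists_conv)
  qed (auto simp: Nbar_def assms(2)[simplified])
  then show "Nbar N i w \<in> lists S" "N (Nbar N i w) = N w"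
    by auto
qed

lemma
  assumes "normalisation S N" "w \<in> lists S"
  shows Nbar_seq_in_lists: "Nbar_seq N u w \<in> lists S"
    and N_Nbar_seq: "N (Nbar_seq N u w) = N w"
proof -
  have "Nbar_seq N u w \<in> lists S \<and> N (Nbar_seq N u w) = N w"
    using assms(2)
  proof (induction u arbitrary: w)
    case (Cons i u)
    show ?case
      using Cons.IH[OF Nbar_in_lists[OF assms(1) Cons.prems, of i]] N_Nbar[OF assms(1) Cons.prems]
      by (simp add: Nbar_seq_def)
  qed (simp add: Nbar_seq_def)
  then show "Nbar_seq N u w \<in> lists S" "N (Nbar_seq N u w) = N w"
    by auto
qed

text \<open>The bound excludes \<open>i = 0\<close>: \<open>Nbar N 0\<close> is the identity, while
  position 1 may change \<open>x\<close>. Beyond the end both sides are unchanged.\<close>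

lemma Nbar_Suc_Cons: "1 \<le> i \<Longrightarrow> Nbar N (Suc i) (x # w) = x # Nbar N i w"
  by (cases i) (auto simp: Nbar_def)

lemma Nbar_seq_map_Suc_Cons:
  "0 \<notin> set u \<Longrightarrow> Nbar_seq N (map Suc u) (x # w) = x # Nbar_seq N u w"
  by (induction u arbitrary: w) (auto simp: Nbar_seq_def Nbar_Suc_Cons)

text \<open>After position 1 the letter \<open>a\<close> is never touched again; the remaining
  positions, lowered by one, carry \<open>b\<close> through \<open>ts\<close>.\<close>

lemma Nbar_seq_sweep_Cons:
  assumes "N [s, t] = [a, b]"
  shows "Nbar_seq N [1..<Suc (length (t # ts))] (s # t # ts) =
    a # Nbar_seq N [1..<Suc (length ts)] (b # ts)"
proof -
  have "[1..<Suc (length (t # ts))] = 1 # map Suc [1..<Suc (length ts)]"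
    by (simp add: upt_conv_Cons map_Suc_upt del: upt_Suc)
  moreover have "Nbar N 1 (s # t # ts) = a # b # ts"
    using assms by (simp add: Nbar_def)
  ultimately show ?thesis
    using Nbar_seq_map_Suc_Cons[of "[1..<Suc (length ts)]" N a "b # ts"]
    by (simp add: Nbar_seq_def del: upt_Suc)
qed

lemma left_domino:
  assumes norm: "normalisation S N" and "quadratic S N" "class_4_3 S N"
    and S: "s \<in> S" "t \<in> S" "t2 \<in> S"
    and "normal N [t, t2]" "N [s, t] = [a, b]" "N [b, t2] = [c, d]"
  shows "normal N [a, c]"
proof -
  have "N [s, t, t2] = Nbar_seq N [2, 1, 2] [s, t, t2]"
    using \<open>class_4_3 S N\<close>[unfolded class_4_3_def, rule_format, of "[s, t, t2]", THEN conjunct2] S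
    by simp
  also have "\<dots> = [a, c, d]"
    using assms(7-9) by (simp add: Nbar_seq_def Nbar_def normal_def)
  finally have "normal N [a, c, d]" "[a, c, d] \<in> lists S"
    using normal_N[OF norm, of "[s, t, t2]"] S norm
    by (auto simp: normalisation_def dest: bspec[of _ _ "[s, t, t2]"])
  then show ?thesis
    using normal_iff_successively[OF \<open>quadratic S N\<close>, of "[a, c, d]"] by simp
qed

lemma normal_sweep:
  assumes norm: "normalisation S N" and quad: "quadratic S N" and cls: "class_4_3 S N"
    and "s \<in> S" "ts \<in> lists S" "normal N ts"
  shows "normal N (Nbar_seq N [1..<Suc (length ts)] (s # ts))"
proof -
  have "successively (\<lambda>x y. normal N [x, y]) ts"
    using normal_iff_successively[OF quad] assms(5,6) by blast
  then have "successively (\<lambda>x y. normal N [x, y]) (Nbar_seq N [1..<Suc (length ts)] (s # ts))"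
    using assms(4,5)
  \<comment> \<open>The letter \<open>s\<close> must vary, since the sweep of the tail starts with
    the carried letter \<open>b\<close>.\<close>
  proof (induction ts arbitrary: s)
    case Nil
    then show ?case by (simp add: Nbar_seq_def)
  next
    case (Cons t ts)
    then have S: "s \<in> S" "t \<in> S" "ts \<in> lists S"
      by auto
    obtain a b where ab: "N [s, t] = [a, b]" "a \<in> S" "b \<in> S"
      using N_pairE[OF norm S(1,2)] .
    have IH: "successively (\<lambda>x y. normal N [x, y]) (Nbar_seq N [1..<Suc (length ts)] (b # ts))"
      using Cons.IH ab S Cons.prems(1) by (cases ts) auto
    show ?case
    proof (cases ts)
      case Nil
      have "normal N [a, b]"
        using normal_N[OF norm, of "[s, t]"] S ab by simp
      then show ?thesis
        unfolding Nbar_seq_sweep_Cons[where N = N, OF ab(1)] using Nil by (simp add: Nbar_seq_def)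
    next
      case ts: (Cons t2 ts')
      have t2: "t2 \<in> S" "normal N [t, t2]"
        using ts S Cons.prems(1) by auto
      obtain c d where cd: "N [b, t2] = [c, d]" "c \<in> S" "d \<in> S"
        using N_pairE[OF norm ab(3) t2(1)] .
      have "normal N [a, c]"
        using left_domino[OF norm quad cls S(1,2) t2 ab(1) cd(1)] .
      \<comment> \<open>Unfolding the sweep twice exposes \<open>c\<close>, the first letter after
        \<open>a\<close>, so \<open>[a, c]\<close> is the only pair not covered by
        \<open>IH\<close>.\<close>
      then show ?thesis
        using IH
        unfolding Nbar_seq_sweep_Cons[where N = N, OF ab(1)] ts Nbar_seq_sweep_Cons[where N = N, OF cd(1)]
        by simp
    qed
  qed
  then show ?thesis
    using normal_iff_successively[OF quad Nbar_seq_in_lists[OF norm]] assms(4,5)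
    by simp
qed

text \<open>The shifted part of \<open>delta\<close> acts on the tail alone and makes it normal by
  induction; the appended positions are then a sweep.\<close>

lemma normal_Nbar_seq_delta:
  assumes norm: "normalisation S N" and quad: "quadratic S N" and cls: "class_4_3 S N"
    and "w \<in> lists S"
  shows "normal N (Nbar_seq N (delta (length w)) w)"
  using assms(4)
proof (induction w rule: induct_list012)
  case (3 x y zs)
  define r where "r = Nbar_seq N (delta (length (y # zs))) (y # zs)"
  \<comment> \<open>Both words have the same value under \<open>N\<close>, and \<open>N\<close>
    preserves length.\<close>
  have "length (Nbar_seq N u v) = length v" if "v \<in> lists S" for u v
    using norm that Nbar_seq_in_lists[OF norm that] N_Nbar_seq[OF norm that]
    unfolding normalisation_def by metis
  then have r: "normal N r" "r \<in> lists S" "length r = length (y # zs)"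
    using 3 Nbar_seq_in_lists[OF norm] by (auto simp: r_def)
  have "0 \<notin> set (delta (length (y # zs)))"
    using set_delta[of "length (y # zs)"] by auto
  then have "Nbar_seq N (delta (length (x # y # zs))) (x # y # zs) =
      Nbar_seq N [1..<Suc (length r)] (x # r)"
    using Nbar_seq_map_Suc_Cons[of "delta (length (y # zs))" N x "y # zs"] r(3)
    by (simp add: Nbar_seq_def r_def del: upt_Suc)
  then show ?case
    using normal_sweep[OF norm quad cls _ r(2,1), of x] 3(3) by simp
qed (simp_all add: Nbar_seq_def normal_iff_successively[OF quad, of "[]"]
    normal_iff_successively[OF quad, of "[_]"])

theorem proposition4p2p3:
  fixes S :: "'a set" and N :: "'a list \<Rightarrow> 'a list"
  assumes "normalisation S N"
    and "quadratic S N"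
    and "class_4_3 S N"
  shows "\<forall>p\<ge>1. \<forall>w\<in>lists S. length w = p \<longrightarrow> N w = Nbar_seq N (delta p) w"
  \<comment> \<open>The normal word reached is its own value under \<open>N\<close>, and this value
    is still \<open>N w\<close>.\<close>
  using normal_Nbar_seq_delta[OF assms] N_Nbar_seq[OF assms(1)]
  by (metis normal_def)

end
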